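(* Let $V$ be a $\mathbb{K}$-vector space with an anticommutative bilinear multiplication $[-,-]$, let $f\in\mathcal{G}(V)$, let $x\bullet y=[x,f(y)]$ (a commutative multiplication), and let $\mu(x,y)=xy=\frac12(x\bullet y+[x,y])$. If $\mu$ satisfies $$\mathcal{AA}(x_1,x_2,x_3)-\mathcal{AA}(x_2,x_1,x_3)-\mathcal{AA}(x_3,x_2,x_1)-\mathcal{AA}(x_1,x_3,x_2)+\mathcal{AA}(x_2,x_3,x_1)+\mathcal{AA}(x_3,x_1,x_2)=0$$ for all $x_1,x_2,x_3\in V$, where $\mathcal{AA}(x_1,x_2,x_3)=(x_1x_2)x_3+x_1(x_2x_3)$ is the antiassociator of $\mu$, then $\mu$ is a depolarization of the pair $(\bullet,[-,-])$ linked by the distributive law $$[x_1,x_2]\bullet x_3+[x_2,x_3]\bullet x_1+[x_3,x_1]\bullet x_2=0\qquad(x_1,x_2,x_3\in V).$$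
   Context: $\mathbb{K}$ is an algebraically closed field of characteristic $0$. For a vector space $V$ with an anticommutative bilinear multiplication $[-,-]$, $\mathcal{G}(V)$ denotes the set of linear endomorphisms $f$ of $V$ satisfying $[f(x),y]+[x,f(y)]=0$ for all $x,y\in V$. The depolarization of a pair $(\bullet,[-,-])$ of a commutative and an anticommutative multiplication is the multiplication $\mu(x,y)=\frac12(x\bullet y+[x,y])$; saying that the depolarized pair is linked by a distributive law means that this law holds for $(\bullet,[-,-])$. (A Hom-Lie algebra here is $V$ with anticommutative $[-,-]$ and an endomorphism $f$ satisfying $[[x_1,x_2],f(x_3)]+[[x_2,x_3],f(x_1)]+[[x_3,x_1],f(x_2)]=0$; with $x\bullet y=[x,f(y)]$ this is the displayed distributive law.) *)

theory Defs
  imports Complex_Main "HOL-Computational_Algebra.Polynomial"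
begin

definition bilinear_mult :: "('k::field \<Rightarrow> 'v::ab_group_add \<Rightarrow> 'v) \<Rightarrow> ('v \<Rightarrow> 'v \<Rightarrow> 'v) \<Rightarrow> bool" where
  "bilinear_mult scale m \<longleftrightarrow>
     (\<forall>x. Vector_Spaces.linear scale scale (\<lambda>y. m x y)) \<and>
     (\<forall>y. Vector_Spaces.linear scale scale (\<lambda>x. m x y))"

definition commutative_mult :: "('k::field \<Rightarrow> 'v::ab_group_add \<Rightarrow> 'v) \<Rightarrow> ('v \<Rightarrow> 'v \<Rightarrow> 'v) \<Rightarrow> bool" where
  "commutative_mult scale m \<longleftrightarrow> bilinear_mult scale m \<and> (\<forall>x y. m x y = m y x)"

definition anticommutative_mult :: "('k::field \<Rightarrow> 'v::ab_group_add \<Rightarrow> 'v) \<Rightarrow> ('v \<Rightarrow> 'v \<Rightarrow> 'v) \<Rightarrow> bool" where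
  "anticommutative_mult scale m \<longleftrightarrow> bilinear_mult scale m \<and> (\<forall>x y. m x y = - m y x)"

definition G_set :: "('k::field \<Rightarrow> 'v::ab_group_add \<Rightarrow> 'v) \<Rightarrow> ('v \<Rightarrow> 'v \<Rightarrow> 'v) \<Rightarrow> ('v \<Rightarrow> 'v) set" where
  "G_set scale br =
     {f. Vector_Spaces.linear scale scale f \<and> (\<forall>x y. br (f x) y + br x (f y) = 0)}"

definition depolarization :: "('k::field \<Rightarrow> 'v::ab_group_add \<Rightarrow> 'v) \<Rightarrow>
    ('v \<Rightarrow> 'v \<Rightarrow> 'v) \<Rightarrow> ('v \<Rightarrow> 'v \<Rightarrow> 'v) \<Rightarrow> 'v \<Rightarrow> 'v \<Rightarrow> 'v" where
  "depolarization scale bul br = (\<lambda>x y. scale (1/2) (bul x y + br x y))"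

text \<open>Being a depolarization of a pair includes that the pair consists of a commutative and an
  anticommutative bilinear multiplication.\<close>

definition is_depolarization_of :: "('k::field \<Rightarrow> 'v::ab_group_add \<Rightarrow> 'v) \<Rightarrow>
    ('v \<Rightarrow> 'v \<Rightarrow> 'v) \<Rightarrow> ('v \<Rightarrow> 'v \<Rightarrow> 'v) \<Rightarrow> ('v \<Rightarrow> 'v \<Rightarrow> 'v) \<Rightarrow> bool" where
  "is_depolarization_of scale mu bul br \<longleftrightarrow>
     commutative_mult scale bul \<and> anticommutative_mult scale br \<and>
     mu = depolarization scale bul br"

definition antiassociator :: "('v::ab_group_add \<Rightarrow> 'v \<Rightarrow> 'v) \<Rightarrow> 'v \<Rightarrow> 'v \<Rightarrow> 'v \<Rightarrow> 'v" where
  "antiassociator m x y z = m (m x y) z + m x (m y z)"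

end

theory Submission
  imports Defs
begin

text \<open>The identity is the alternating sum of the antiassociator over \<open>S\<^sub>3\<close>. Summing first over
  the transposition of the two inner arguments turns the inner products into commutators
  \<open>xy - yx = [x,y]\<close>; the two halves of the antiassociator then combine to
  \<open>[x,y]z + z[x,y] = [x,y] \<bullet> z\<close>, so the identity is the distributive law itself.\<close>

lemma alternating_antiassociator:
  fixes m :: "'v::ab_group_add \<Rightarrow> 'v \<Rightarrow> 'v"
  assumes l: "\<And>x y z. m (x - y) z = m x z - m y z"
    and r: "\<And>x y z. m x (y - z) = m x y - m x z"
  shows "antiassociator m x y z - antiassociator m y x z
       - antiassociator m z y x - antiassociator m x z y
       + antiassociator m y z x + antiassociator m z x y
     = (m (m x y - m y x) z + m z (m x y - m y x))
     + (m (m y z - m z y) x + m x (m y z - m z y))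
     + (m (m z x - m x z) y + m y (m z x - m x z))"
  \<comment> \<open>Additivity expands both sides into the same twelve signed monomials, each of the
    six permutations contributing one per bracketing. What remains is reordering in an abelian
    group.\<close>
  unfolding antiassociator_def l r by (simp only: diff_conv_add_uminus minus_add_distrib minus_minus ac_simps)

lemma bilinear_mult_diff:
  assumes "bilinear_mult scale m"
  shows "m (x - y) z = m x z - m y z" "m x (y - z) = m x y - m x z"
proof -
  have "Vector_Spaces.linear scale scale (\<lambda>x. m x z)" "Vector_Spaces.linear scale scale (m x)"
    using assms unfolding bilinear_mult_def by auto
  then interpret L: Vector_Spaces.linear scale scale "\<lambda>x. m x z" +
    R: Vector_Spaces.linear scale scale "m x" .
  show "m (x - y) z = m x z - m y z" "m x (y - z) = m x y - m x z"
    by (rule L.diff, rule R.diff)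
qed

lemma bilinear_mult_comp_right:
  assumes "bilinear_mult scale m" "Vector_Spaces.linear scale scale f"
  shows "bilinear_mult scale (\<lambda>x y. m x (f y))"
  using assms Vector_Spaces.linear_compose[of scale scale f scale]
  unfolding bilinear_mult_def by (auto simp: o_def)

text \<open>Two signs cancel: moving \<open>f\<close> across the bracket costs one, and swapping the
  arguments of \<open>br\<close> costs the other.\<close>

lemma commutative_mult_twist:
  assumes br: "anticommutative_mult scale br" and f: "f \<in> G_set scale br"
  shows "commutative_mult scale (\<lambda>x y. br x (f y))"
proof -
  have "br x (f y) = br y (f x)" for x y
  proof -
    have "br (f x) y + br x (f y) = 0" "br (f x) y = - br y (f x)"
      using br f unfolding G_set_def anticommutative_mult_def by blast+
    then show ?thesis by (simp only: add_eq_0_iff minus_minus)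
  qed
  moreover have "bilinear_mult scale (\<lambda>x y. br x (f y))"
    using br f unfolding anticommutative_mult_def G_set_def
    by (blast intro: bilinear_mult_comp_right)
  ultimately show ?thesis
    unfolding commutative_mult_def by blast
qed

context
  fixes scale :: "'k::field_char_0 \<Rightarrow> 'v::ab_group_add \<Rightarrow> 'v"
    and bul br :: "'v \<Rightarrow> 'v \<Rightarrow> 'v"
  assumes vs: "vector_space scale"
    and bul: "commutative_mult scale bul"
    and br: "anticommutative_mult scale br"
begin

interpretation vector_space scale by (fact vs)

text \<open>Characteristic 0 enters here: 2 is invertible, so \<open>1/2 + 1/2 = 1\<close>.\<close>

lemma scale_half_double: "scale (1/2) (v + v) = v"
proof -
  have "scale (1/2) (v + v) = scale (1/2 + 1/2) v"
    by (simp only: scale_right_distrib scale_left_distrib)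
  then show ?thesis by simp
qed

text \<open>Swapping the arguments fixes the \<open>bul\<close> part and negates the
  \<open>br\<close> part, so the difference cancels the former and doubles the latter. With the sum
  in place of the difference the roles are exchanged; thus the product determines the pair.\<close>

lemma depolarization_commutator:
  "depolarization scale bul br x y - depolarization scale bul br y x = br x y"
proof -
  have "bul y x = bul x y" "br y x = - br x y"
    using bul br unfolding commutative_mult_def anticommutative_mult_def by blast+
  then show ?thesis
    using scale_half_double[of "br x y"]
    by (simp add: depolarization_def flip: scale_right_diff_distrib)
qed

lemma depolarization_anticommutator:
  "depolarization scale bul br x y + depolarization scale bul br y x = bul x y"
proof -
  have "bul y x = bul x y" "br y x = - br x y"
    using bul br unfolding commutative_mult_def anticommutative_mult_def by blast+
  then show ?thesis
    using scale_half_double[of "bul x y"]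
    by (simp add: depolarization_def flip: scale_right_distrib)
qed

text \<open>Inner commutators become \<open>br\<close> and outer anticommutators become
  \<open>bul\<close>. As this is an identity for every such pair, the alternating sum vanishes
  exactly when the distributive law holds.\<close>

lemma depolarization_alternating_antiassociator:
  defines "mu \<equiv> depolarization scale bul br"
  shows "antiassociator mu x y z - antiassociator mu y x z
       - antiassociator mu z y x - antiassociator mu x z y
       + antiassociator mu y z x + antiassociator mu z x y
     = bul (br x y) z + bul (br y z) x + bul (br z x) y"
proof -
  have "bilinear_mult scale bul" "bilinear_mult scale br"
    using bul br unfolding commutative_mult_def anticommutative_mult_def by blast+
  note diffs = this[THEN bilinear_mult_diff(1)] this[THEN bilinear_mult_diff(2)]
  \<comment> \<open>\<open>mu\<close> inherits additivity in each argument from \<open>bul\<close>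
    and \<open>br\<close>, which is what the expansion of the alternating sum requires.\<close>
  have "mu (a - b) c = mu a c - mu b c" "mu a (b - c) = mu a b - mu a c" for a b c
    unfolding mu_def depolarization_def scale_right_diff_distrib[symmetric]
    by (simp_all add: diffs algebra_simps)
  then show ?thesis
    by (subst alternating_antiassociator)
      (simp_all add: mu_def depolarization_commutator depolarization_anticommutator)
qed

end

theorem theorem13:
  fixes scale :: "'k::{alg_closed_field, field_char_0} \<Rightarrow> 'v::ab_group_add \<Rightarrow> 'v"
    and br bul mu :: "'v \<Rightarrow> 'v \<Rightarrow> 'v"
    and f :: "'v \<Rightarrow> 'v"
  assumes "vector_space scale"
    and "anticommutative_mult scale br"
    and "f \<in> G_set scale br"
    and "bul = (\<lambda>x y. br x (f y))"
    and "mu = (\<lambda>x y. scale (1/2) (bul x y + br x y))"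
    and "\<And>x1 x2 x3.
           antiassociator mu x1 x2 x3 - antiassociator mu x2 x1 x3
         - antiassociator mu x3 x2 x1 - antiassociator mu x1 x3 x2
         + antiassociator mu x2 x3 x1 + antiassociator mu x3 x1 x2 = 0"
  shows "is_depolarization_of scale mu bul br \<and>
         (\<forall>x1 x2 x3. bul (br x1 x2) x3 + bul (br x2 x3) x1 + bul (br x3 x1) x2 = 0)"
proof -
  \<comment> \<open>Membership of \<open>f\<close> in \<open>G_set scale br\<close> serves to make
    \<open>bul\<close> commutative, so that the pair is one to which polarization applies.\<close>
  have bul: "commutative_mult scale bul"
    using commutative_mult_twist[OF assms(2,3)] assms(4) by simp
  have mu: "mu = depolarization scale bul br"
    using assms(5) by (simp add: depolarization_def)
  have "bul (br x1 x2) x3 + bul (br x2 x3) x1 + bul (br x3 x1) x2 = 0" for x1 x2 x3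
    using depolarization_alternating_antiassociator[OF assms(1) bul assms(2), of x1 x2 x3]
      assms(6)[of x1 x2 x3] unfolding mu by simp
  then show ?thesis
    using bul mu assms(2) by (simp add: is_depolarization_of_def)
qed

end
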